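(* For all positive integers $n \ge d \ge 2$ there exists a collection $\mathcal{A} \subset \mathcal{P}([n]^d)$ with $|\mathcal{A}| = |\mathcal{P}([n]^d)|/2$ such that there is no pair $(A,B) \in \mathcal{A} \times \mathcal{A}$ satisfying $A \,\Delta\, B = S^d$ for some non-empty subset $S \subset [n]$ that can be written as a union of at most $\lfloor d/2 \rfloor$ intervals.
   Context: $[n]=\{1,\dots,n\}$; for integers $a \le b$, $[a,b]=\{a,a+1,\dots,b\}$ is called an interval. $\mathcal{P}(X)$ denotes the power set of $X$, $A\,\Delta\, B$ the symmetric difference, and $S^d = S\times\dots\times S \subset [n]^d$ ($d$ factors). *)

theory Defs
  imports Complex_Main "HOL-Library.FuncSet"
begin

text \<open>The d-fold Cartesian power of S: d-tuples are extensional functions on the index set {1..d}.\<close>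

definition cart_power :: "nat set \<Rightarrow> nat \<Rightarrow> (nat \<Rightarrow> nat) set" where
  "cart_power S d = ({1..d} \<rightarrow>\<^sub>E S)"

definition int_interval :: "nat set \<Rightarrow> bool" where
  "int_interval I \<longleftrightarrow> (\<exists>a b. a \<le> b \<and> I = {a..b})"

definition union_of_at_most_intervals :: "nat \<Rightarrow> nat set \<Rightarrow> bool" where
  "union_of_at_most_intervals k S \<longleftrightarrow>
     (\<exists>\<I>. finite \<I> \<and> card \<I> \<le> k \<and> (\<forall>I\<in>\<I>. int_interval I) \<and> S = \<Union>\<I>)"

end

theory Submission
  imports Defs
begin

text \<open>It suffices to find a set \<open>W\<close> of \<open>d\<close>-tuples meeting \<open>S\<^sup>d\<close> in an odd number of points for every
  admissible \<open>S\<close>: then the sets \<open>A\<close> with \<open>\<bar>A \<inter> W\<bar>\<close> even form the required family. Since a tuple lies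
  in \<open>S\<^sup>d\<close> iff its image lies in \<open>S\<close>, the functions \<open>S \<mapsto> \<bar>W \<inter> S\<^sup>d\<bar> mod 2\<close> are exactly the
  polynomials of degree at most \<open>d\<close> over the two-element field, without constant term, in the
  indicator variables \<open>x\<^sub>i\<close> of \<open>S\<close>. The maximal intervals of \<open>S\<close> correspond to their left endpoints,
  detected by the quadratic polynomials \<open>y\<^sub>i = x\<^sub>i (1 - x\<^sub>i\<^sub>-\<^sub>1)\<close>. The sum of the elementary symmetric
  polynomials \<open>e\<^sub>1, \<dots>, e\<^sub>k\<close> in the \<open>y\<^sub>i\<close>, where \<open>k = \<lfloor>d/2\<rfloor>\<close>, has degree at most \<open>2k \<le> d\<close>, and it
  counts the non-empty sets of at most \<open>k\<close> left endpoints. If \<open>S\<close> has \<open>m\<close> left endpoints with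
  \<open>1 \<le> m \<le> k\<close>, this number is \<open>2\<^sup>m - 1\<close>, which is odd.\<close>

lemma even_card_sym_diff:
  assumes "finite A" "finite B"
  shows "even (card (sym_diff A B)) \<longleftrightarrow> even (card A + card B)"
proof -
  have "card A = card (A \<inter> B) + card (A - B)" "card B = card (A \<inter> B) + card (B - A)"
    using assms card_Int_Diff[of A B] card_Int_Diff[of B A] by (simp_all add: Int_commute)
  moreover have "card (sym_diff A B) = card (A - B) + card (B - A)"
    using assms by (intro card_Un_disjoint) auto
  ultimately show ?thesis by auto
qed

lemma even_card_sym_diff_Int:
  assumes "finite (A \<inter> W)" "finite (B \<inter> W)"
  shows "even (card (sym_diff A B \<inter> W)) \<longleftrightarrow> even (card (A \<inter> W) + card (B \<inter> W))"
proof -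
  have "sym_diff A B \<inter> W = sym_diff (A \<inter> W) (B \<inter> W)" by auto
  then show ?thesis by (simp only: even_card_sym_diff[OF assms])
qed

lemma odd_card_Pow_iff: "finite A \<Longrightarrow> odd (card (Pow A)) \<longleftrightarrow> A = {}"
  by (simp add: card_Pow)

lemma odd_card_Sigma_iff:
  assumes "finite A" "\<And>a. a \<in> A \<Longrightarrow> finite (B a)"
  shows "odd (card (Sigma A B)) \<longleftrightarrow> odd (card {a \<in> A. odd (card (B a))})"
  using assms by (simp add: card_SigmaI even_sum_iff)

lemma card_Pow_even_Int:
  assumes "finite U" "U \<inter> W \<noteq> {}"
  shows "2 * card {A \<in> Pow U. even (card (A \<inter> W))} = card (Pow U)"
proof -
  obtain w where w: "w \<in> U" "w \<in> W" using assms(2) by auto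
  let ?even = "{A \<in> Pow U. even (card (A \<inter> W))}" and ?odd = "{A \<in> Pow U. odd (card (A \<inter> W))}"
  let ?flip = "\<lambda>A. sym_diff A {w}"
  have flip_parity: "even (card (?flip A \<inter> W)) \<longleftrightarrow> odd (card (A \<inter> W))" if "A \<subseteq> U" for A
    using even_card_sym_diff_Int[of A W "{w}"] finite_subset[OF that assms(1)] w(2) by simp
  have flip_subset: "?flip A \<subseteq> U" if "A \<subseteq> U" for A
    using that w(1) by auto
  have flip_flip: "?flip (?flip A) = A" for A by auto
  have "bij_betw ?flip ?even ?odd"
    by (rule bij_betw_byWitness[where f' = ?flip]) (use flip_parity flip_subset flip_flip in auto)
  then have "card ?even = card ?odd" by (rule bij_betw_same_card)
  moreover have "card (Pow U) = card ?even + card ?odd"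
    using assms(1) by (subst card_Un_disjoint[symmetric]) (auto intro: arg_cong[where f = card])
  ultimately show ?thesis by simp
qed

lemma exists_half_family_avoiding_sym_diffs:
  assumes "finite U" "U \<inter> W \<noteq> {}" "\<forall>D\<in>\<D>. odd (card (D \<inter> W))"
  obtains \<A> where "\<A> \<subseteq> Pow U" "2 * card \<A> = card (Pow U)"
    "\<forall>A\<in>\<A>. \<forall>B\<in>\<A>. sym_diff A B \<notin> \<D>"
proof
  let ?\<A> = "{A \<in> Pow U. even (card (A \<inter> W))}"
  show "?\<A> \<subseteq> Pow U" by auto
  show "2 * card ?\<A> = card (Pow U)" using assms(1,2) by (rule card_Pow_even_Int)
  show "\<forall>A\<in>?\<A>. \<forall>B\<in>?\<A>. sym_diff A B \<notin> \<D>"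
  proof (intro ballI)
    fix A B assume AB: "A \<in> ?\<A>" "B \<in> ?\<A>"
    then have "finite A" "finite B" using assms(1) finite_subset by auto
    then have "even (card (sym_diff A B \<inter> W))" using AB by (simp add: even_card_sym_diff_Int)
    then show "sym_diff A B \<notin> \<D>" using assms(3) by blast
  qed
qed

lemma exists_extensional_with_image:
  assumes "finite I" "finite T" "T \<noteq> {}" "card T \<le> card I"
  obtains w where "w \<in> extensional I" "w ` I = T"
proof -
  obtain g where "g ` I = T"
    using assms by (metis inj_on_iff_card_le inj_on_iff_surj)
  then show ?thesis by (intro that[of "restrict g I"]) auto
qed

lemma mem_PiE_const_iff: "w \<in> (I \<rightarrow>\<^sub>E S) \<longleftrightarrow> w \<in> extensional I \<and> w ` I \<subseteq> S"
  by (auto simp: PiE_iff)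

text \<open>The index set \<open>P\<close> lists the monomials of a polynomial, \<open>vars p\<close> being the set of variables of
  the monomial \<open>p\<close>.\<close>

lemma exists_tuples_with_parity:
  assumes "finite I" "finite P"
    and vars: "\<And>p. p \<in> P \<Longrightarrow> finite (vars p) \<and> vars p \<noteq> {} \<and> card (vars p) \<le> card I"
  shows "\<exists>W. finite W \<and> (\<forall>S. odd (card (W \<inter> (I \<rightarrow>\<^sub>E S))) \<longleftrightarrow> odd (card {p \<in> P. vars p \<subseteq> S}))"
  using assms(2) vars
proof (induction P)
  case empty
  show ?case by (intro exI[of _ "{}"]) simp
next
  case (insert p P)
  obtain W where "finite W"
    and W: "\<And>S. odd (card (W \<inter> (I \<rightarrow>\<^sub>E S))) \<longleftrightarrow> odd (card {q \<in> P. vars q \<subseteq> S})"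
    using insert.IH insert.prems by auto
  obtain w where w: "w \<in> extensional I" "w ` I = vars p"
    using exists_extensional_with_image[of I "vars p"] assms(1) insert.prems by auto
  have "odd (card (sym_diff W {w} \<inter> (I \<rightarrow>\<^sub>E S))) \<longleftrightarrow> odd (card {q \<in> insert p P. vars q \<subseteq> S})" for S
  proof -
    have "{w} \<inter> (I \<rightarrow>\<^sub>E S) = (if vars p \<subseteq> S then {w} else {})"
      using w by (auto simp: mem_PiE_const_iff)
    then have "odd (card (sym_diff W {w} \<inter> (I \<rightarrow>\<^sub>E S))) \<longleftrightarrow>
        odd (card {q \<in> P. vars q \<subseteq> S} + (if vars p \<subseteq> S then 1 else 0))"
      using \<open>finite W\<close> W[of S] by (simp add: even_card_sym_diff_Int)
    moreover have "{q \<in> insert p P. vars q \<subseteq> S} =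
        (if vars p \<subseteq> S then insert p {q \<in> P. vars q \<subseteq> S} else {q \<in> P. vars q \<subseteq> S})"
      by auto
    ultimately show ?thesis using insert.hyps by simp
  qed
  then show ?case using \<open>finite W\<close> by (intro exI[of _ "sym_diff W {w}"]) simp
qed

definition left_endpoints :: "nat set \<Rightarrow> nat set" where
  "left_endpoints S = S - Suc ` S"

lemma finite_left_endpoints: "finite S \<Longrightarrow> finite (left_endpoints S)"
  by (simp add: left_endpoints_def)

lemma left_endpoints_atLeastAtMost: "a \<le> b \<Longrightarrow> left_endpoints {a..b} = {a}"
  by (auto simp: left_endpoints_def image_Suc_atLeastAtMost)

lemma left_endpoints_nonempty:
  assumes "S \<noteq> {}"
  shows "left_endpoints S \<noteq> {}"
proof -
  have "Inf S \<notin> Suc ` S" by (auto dest: wellorder_Inf_le1)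
  then show ?thesis using Inf_nat_def1[OF assms] by (auto simp: left_endpoints_def)
qed

lemma card_left_endpoints_le:
  assumes "union_of_at_most_intervals k S"
  shows "card (left_endpoints S) \<le> k"
proof -
  obtain \<I> where \<I>: "finite \<I>" "card \<I> \<le> k" "\<And>I. I \<in> \<I> \<Longrightarrow> int_interval I" "S = \<Union>\<I>"
    using assms unfolding union_of_at_most_intervals_def by blast
  have "left_endpoints S \<subseteq> Inf ` \<I>"
  proof
    fix i assume i: "i \<in> left_endpoints S"
    then obtain I where I: "I \<in> \<I>" "i \<in> I" using \<I>(4) by (auto simp: left_endpoints_def)
    then obtain a b where ab: "a \<le> b" "I = {a..b}"
      using \<I>(3) unfolding int_interval_def by blast
    have "i \<notin> Suc ` I" using i I(1) \<I>(4) by (auto simp: left_endpoints_def)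
    then have "i = a" using I(2) ab(2) by (cases i) force+
    then show "i \<in> Inf ` \<I>" using I(1) ab by force
  qed
  then have "card (left_endpoints S) \<le> card \<I>"
    using \<I>(1) surj_card_le by blast
  then show ?thesis using \<I>(2) by simp
qed

text \<open>The pairs \<open>(J, K)\<close> index the monomials in the expansion of \<open>e\<^sub>1 + \<dots> + e\<^sub>k\<close>: \<open>J\<close> selects the
  factors \<open>y\<^sub>i = x\<^sub>i - x\<^sub>i x\<^sub>i\<^sub>-\<^sub>1\<close>, and \<open>K\<close> consists of the \<open>i - 1\<close> for which the second term is taken.
  The variables of the monomial are those in \<open>J \<union> K\<close>.\<close>

definition endpoint_monomials :: "nat set \<Rightarrow> nat \<Rightarrow> (nat set \<times> nat set) set" where
  "endpoint_monomials N k = (SIGMA J:{J. J \<subseteq> N \<and> J \<noteq> {} \<and> card J \<le> k}. Pow (Suc -` J))"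

lemma finite_endpoint_monomials:
  assumes "finite N"
  shows "finite (endpoint_monomials N k)"
proof -
  have "finite (Suc -` J)" if "J \<subseteq> N" for J
    using finite_subset[OF that assms] inj_Suc by (rule finite_vimageI)
  then show ?thesis using assms by (auto simp: endpoint_monomials_def)
qed

lemma endpoint_monomial_vars:
  assumes "finite N" "(J, K) \<in> endpoint_monomials N k"
  shows "finite (J \<union> K)" "J \<union> K \<noteq> {}" "card (J \<union> K) \<le> 2 * k"
proof -
  have JK: "J \<subseteq> N" "J \<noteq> {}" "card J \<le> k" "K \<subseteq> Suc -` J"
    using assms(2) by (auto simp: endpoint_monomials_def)
  have "finite J" using JK(1) assms(1) by (rule finite_subset)
  then have "finite (Suc -` J)" using inj_Suc by (rule finite_vimageI)
  then show "finite (J \<union> K)" using \<open>finite J\<close> JK(4) finite_subset by auto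
  show "J \<union> K \<noteq> {}" using JK(2) by simp
  have "card K \<le> card (Suc -` J)" using \<open>finite (Suc -` J)\<close> JK(4) by (rule card_mono)
  also have "\<dots> \<le> card J" using card_vimage_inj_on_le[of Suc UNIV J] \<open>finite J\<close> by simp
  finally show "card (J \<union> K) \<le> 2 * k" using card_Un_le[of J K] JK(3) by linarith
qed

lemma odd_card_nonempty_subsets:
  assumes "finite L" "L \<noteq> {}"
  shows "odd (card {J. J \<subseteq> L \<and> J \<noteq> {}})"
proof -
  have "{J. J \<subseteq> L \<and> J \<noteq> {}} = Pow L - {{}}" by auto
  then show ?thesis using assms by (simp add: card_Pow)
qed

lemma odd_card_endpoint_monomials:
  assumes "finite N" "S \<subseteq> N" "S \<noteq> {}" "card (left_endpoints S) \<le> k"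
  shows "odd (card {(J, K) \<in> endpoint_monomials N k. J \<union> K \<subseteq> S})" (is "odd (card ?M)")
proof -
  let ?L = "left_endpoints S" and ?\<J> = "{J. J \<subseteq> S \<and> J \<noteq> {} \<and> card J \<le> k}"
  have "finite S" using assms(1,2) by (rule rev_finite_subset)
  then have "finite ?L" by (rule finite_left_endpoints)
  have odd_iff: "odd (card (Pow (Suc -` J \<inter> S))) \<longleftrightarrow> J \<subseteq> ?L" if "J \<subseteq> S" for J
    using \<open>finite S\<close> that by (subst odd_card_Pow_iff) (auto simp: left_endpoints_def)
  have "?M = (SIGMA J:?\<J>. Pow (Suc -` J \<inter> S))"
    using assms(2) by (auto simp: endpoint_monomials_def)
  also have "odd (card \<dots>) \<longleftrightarrow> odd (card {J \<in> ?\<J>. odd (card (Pow (Suc -` J \<inter> S)))})"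
    using \<open>finite S\<close> by (intro odd_card_Sigma_iff) simp_all
  also have "{J \<in> ?\<J>. odd (card (Pow (Suc -` J \<inter> S)))} = {J. J \<subseteq> ?L \<and> J \<noteq> {} \<and> card J \<le> k}"
    using odd_iff by (auto simp: left_endpoints_def)
  also have "\<dots> = {J. J \<subseteq> ?L \<and> J \<noteq> {}}"
    using card_mono[OF \<open>finite ?L\<close>] assms(4) by (auto intro: order_trans)
  finally show ?thesis
    using odd_card_nonempty_subsets[OF \<open>finite ?L\<close> left_endpoints_nonempty[OF assms(3)]] by simp
qed

lemma exists_tuples_meeting_powers_oddly:
  assumes "finite I" "finite N" "2 * k \<le> card I"
  obtains W where "\<And>S. S \<subseteq> N \<Longrightarrow> S \<noteq> {} \<Longrightarrow> card (left_endpoints S) \<le> k \<Longrightarrow>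
    odd (card ((I \<rightarrow>\<^sub>E S) \<inter> W))"
proof -
  let ?vars = "\<lambda>(J, K). J \<union> K"
  have "finite (?vars p) \<and> ?vars p \<noteq> {} \<and> card (?vars p) \<le> card I"
    if "p \<in> endpoint_monomials N k" for p
    using that endpoint_monomial_vars[OF assms(2)] assms(3)
    by (cases p) (fastforce intro: order_trans)
  then obtain W where W: "\<And>S. odd (card (W \<inter> (I \<rightarrow>\<^sub>E S))) \<longleftrightarrow>
      odd (card {p \<in> endpoint_monomials N k. ?vars p \<subseteq> S})"
    using exists_tuples_with_parity[OF assms(1) finite_endpoint_monomials[OF assms(2)], of k ?vars]
    by blast
  show ?thesis
  proof
    fix S assume "S \<subseteq> N" "S \<noteq> {}" "card (left_endpoints S) \<le> k"
    then have "odd (card {(J, K) \<in> endpoint_monomials N k. J \<union> K \<subseteq> S})"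
      by (rule odd_card_endpoint_monomials[OF assms(2)])
    then show "odd (card ((I \<rightarrow>\<^sub>E S) \<inter> W))"
      using W[of S] by (simp add: Int_commute case_prod_unfold)
  qed
qed

theorem theorem1p3:
  fixes n d :: nat
  assumes "d \<ge> 2" and "n \<ge> d"
  shows "\<exists>\<A>. \<A> \<subseteq> Pow (cart_power {1..n} d) \<and>
           real (card \<A>) = real (card (Pow (cart_power {1..n} d))) / 2 \<and>
           \<not> (\<exists>(A, B) \<in> \<A> \<times> \<A>. \<exists>S. S \<noteq> {} \<and> S \<subseteq> {1..n} \<and>
                 union_of_at_most_intervals (d div 2) S \<and>
                 sym_diff A B = cart_power S d)"
proof -
  let ?U = "cart_power {1..n} d"
  define \<D> where "\<D> = {cart_power S d |S.
    S \<noteq> {} \<and> S \<subseteq> {1..n} \<and> union_of_at_most_intervals (d div 2) S}"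
  obtain W where W: "\<And>S. S \<subseteq> {1..n} \<Longrightarrow> S \<noteq> {} \<Longrightarrow> card (left_endpoints S) \<le> d div 2 \<Longrightarrow>
      odd (card (cart_power S d \<inter> W))"
    unfolding cart_power_def
    by (rule exists_tuples_meeting_powers_oddly[of "{1..d}" "{1..n}" "d div 2"]) auto
  have "finite ?U" by (simp add: cart_power_def finite_PiE)
  moreover have "?U \<inter> W \<noteq> {}"
    using W[of "{1..n}"] assms by (intro odd_card_imp_not_empty)
      (simp add: left_endpoints_atLeastAtMost)
  moreover have "\<forall>D\<in>\<D>. odd (card (D \<inter> W))"
    unfolding \<D>_def using W card_left_endpoints_le by blast
  ultimately obtain \<A> where "\<A> \<subseteq> Pow ?U" and half: "2 * card \<A> = card (Pow ?U)"
    and "\<forall>A\<in>\<A>. \<forall>B\<in>\<A>. sym_diff A B \<notin> \<D>"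
    by (rule exists_half_family_avoiding_sym_diffs)
  moreover have "real (card \<A>) = real (card (Pow ?U)) / 2"
    unfolding half[symmetric] by simp
  ultimately show ?thesis unfolding \<D>_def by (intro exI[of _ \<A>]) blast
qed

end
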